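(* Let $n,m\ge 1$, let $(u_i)_{i=1}^m$ be a sequence of Euclidean unit vectors in $\mathbb{R}^n$ and let $(c_i)_{i=1}^m$ be a sequence of positive real numbers satisfying (a) $\sum_{i=1}^m c_i u_i = 0$ and (b) $\sum_{i=1}^m c_i\, u_i\otimes u_i = I_n$. Let $K=\{x\in\mathbb{R}^n : \langle x,u_i\rangle\le 1 \text{ for all } 1\le i\le m\}$. If $1\le k\le n$ and $\mathcal{E}$ is a $k$-dimensional ellipsoid contained in $K$, then the $k$-dimensional volume of $\mathcal{E}$ is no larger than that of a $k$-dimensional Euclidean ball of radius $\sqrt{\frac{n(n+1)}{k(k+1)}}$.
   Context: $\langle\cdot,\cdot\rangle$ is the standard inner product on $\mathbb{R}^n$ and $I_n$ is the identity operator on $\mathbb{R}^n$. For $u\in\mathbb{R}^n$, $u\otimes u$ denotes the operator $x\mapsto\langle u,x\rangle u$; thus (b) says $\sum_i c_i\langle u_i,x\rangle\langle u_i,y\rangle=\langle x,y\rangle$ for all $x,y\in\mathbb{R}^n$. A $k$-dimensional ellipsoid in $\mathbb{R}^n$ is a set of the form $\{x\in\mathbb{R}^n:\sum_{j=1}^k\alpha_j^{-2}\langle x-y,v_j\rangle^2\le 1,\ \langle x-y,v_j\rangle=0\text{ for }k+1\le j\le n\}$, where $y\in\mathbb{R}^n$ (the centre, not necessarily the origin), $(v_j)_{j=1}^n$ is an orthonormal basis of $\mathbb{R}^n$ and $(\alpha_j)_{j=1}^k$ are positive numbers (the semi-axis lengths). Its $k$-dimensional volume is $\prod_{j=1}^k\alpha_j$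 times the volume of the unit ball of $\mathbb{R}^k$. *)

theory Defs
  imports "HOL-Analysis.Analysis"
begin

definition tensor_square :: "real ^ 'n \<Rightarrow> real ^ 'n \<Rightarrow> real ^ 'n" where
  "tensor_square u = (\<lambda>x. (u \<bullet> x) *\<^sub>R u)"

definition orthonormal_basis :: "(nat \<Rightarrow> real ^ 'n) \<Rightarrow> bool" where
  "orthonormal_basis v \<longleftrightarrow>
     (\<forall>i\<in>{1..CARD('n)}. \<forall>j\<in>{1..CARD('n)}. v i \<bullet> v j = (if i = j then 1 else 0)) \<and>
     span (v ` {1..CARD('n)}) = UNIV"

definition ellipsoid ::
  "nat \<Rightarrow> real ^ 'n \<Rightarrow> (nat \<Rightarrow> real ^ 'n) \<Rightarrow> (nat \<Rightarrow> real) \<Rightarrow> (real ^ 'n) set" where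
  "ellipsoid k y v \<alpha> =
     {x. (\<Sum>j=1..k. ((x - y) \<bullet> v j)\<^sup>2 / (\<alpha> j)\<^sup>2) \<le> 1 \<and>
         (\<forall>j\<in>{k+1..CARD('n)}. (x - y) \<bullet> v j = 0)}"

text \<open>
  The \<open>k\<close>-dimensional volume of an ellipsoid with semi-axis lengths
  \<open>\<alpha> 1, \<dots>, \<alpha> k\<close>. The volume of the unit ball of \<open>k\<close>-dimensional Euclidean space
  is \<^const>\<open>unit_ball_vol\<close> at \<open>k\<close>; see \<open>content_cball\<close>.
\<close>

definition ellipsoid_volume :: "nat \<Rightarrow> (nat \<Rightarrow> real) \<Rightarrow> real" where
  "ellipsoid_volume k \<alpha> = (\<Prod>j=1..k. \<alpha> j) * unit_ball_vol (real k)"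

definition ball_volume :: "nat \<Rightarrow> real \<Rightarrow> real" where
  "ball_volume k r = r ^ k * unit_ball_vol (real k)"

end

theory Submission
  imports Defs
begin

text \<open>
  Write \<open>S = \<alpha>\<^sub>1 + \<dots> + \<alpha>\<^sub>k\<close> and let \<open>A\<close> be the operator with \<open>A v\<^sub>j = \<alpha>\<^sub>j v\<^sub>j\<close> for \<open>j \<le> k\<close> and
  \<open>A v\<^sub>j = 0\<close> otherwise. Containment of the ellipsoid in \<open>K\<close> means
  \<open>|A u\<^sub>i| \<le> 1 - \<langle>u\<^sub>i, y\<rangle>\<close> for all \<open>i\<close>. Squaring and summing against \<open>c\<^sub>i\<close> gives
  \<open>\<Sum> \<alpha>\<^sub>j\<^sup>2 \<le> n + |y|\<^sup>2\<close>.

  Put \<open>R\<^sup>2 = S\<^sup>2 + |y|\<^sup>2\<close>. The Lorentz boost along \<open>y\<close> of speed \<open>|y| / R\<close> sends the null vector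
  \<open>(1, u)\<close>, up to a factor, to \<open>(R + \<langle>u, y\<rangle>, w(u))\<close> with
  \<open>w(u) = S u + (1 + \<langle>u, y\<rangle> / (R + S)) y\<close>, so \<open>|w(u)| = R + \<langle>u, y\<rangle>\<close> and hence
  \<open>\<langle>w(u\<^sub>i), A u\<^sub>i\<rangle> \<le> (R + \<langle>u\<^sub>i, y\<rangle>) (1 - \<langle>u\<^sub>i, y\<rangle>)\<close>. Summing against \<open>c\<^sub>i\<close> gives
  \<open>S\<^sup>2 \<le> n R - |y|\<^sup>2\<close>, that is \<open>R \<le> n\<close>, or \<open>S\<^sup>2 + |y|\<^sup>2 \<le> n\<^sup>2\<close>.

  Eliminating \<open>|y|\<close> with \<open>S\<^sup>2 \<le> k \<Sum> \<alpha>\<^sub>j\<^sup>2\<close> yields \<open>(k + 1) S\<^sup>2 \<le> k n (n + 1)\<close>, and the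
  inequality of arithmetic and geometric means finishes the proof.
\<close>

text \<open>With \<open>x = u \<bullet> y\<close> and \<open>q = 1 + x / (R + S)\<close>, the
  factorisation \<open>|y|^2 = (R - S) (R + S)\<close> and \<open>q (R + S) = R + S + x\<close> turn
  the expanded squared norm into the perfect square \<open>(R + x)^2\<close>.\<close>

lemma norm_lorentz_boost:
  fixes u y :: "'a::real_inner"
  assumes u: "norm u = 1" and S: "0 < S" and R: "R = sqrt (S\<^sup>2 + (norm y)\<^sup>2)"
  shows "norm (S *\<^sub>R u + (1 + (u \<bullet> y) / (R + S)) *\<^sub>R y) = R + u \<bullet> y"
proof -
  define x where "x = u \<bullet> y"
  define q where "q = 1 + x / (R + S)"
  have "R\<^sup>2 = S\<^sup>2 + y \<bullet> y"
    unfolding R by (simp add: power2_norm_eq_inner)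
  then have yy: "y \<bullet> y = R * R - S * S"
    by (simp add: power2_eq_square)
  have "0 \<le> R"
    unfolding R by simp
  with S have RS: "R + S > 0"
    by simp
  have q: "q * (R + S) = R + S + x"
    using RS by (simp add: q_def field_simps)
  \<comment> \<open>The sign of \<open>R + x\<close> decides which square root of
    \<open>(R + x)^2\<close> the norm is.\<close>
  have "\<bar>x\<bar> \<le> norm y"
    using Cauchy_Schwarz_ineq2[of u y] u by (simp add: x_def)
  also have "norm y \<le> R"
    unfolding R by (rule real_le_rsqrt) simp
  finally have pos: "R + x \<ge> 0"
    by simp
  have uu: "u \<bullet> u = 1"
    using u by (metis norm_eq_1)
  have "(norm (S *\<^sub>R u + q *\<^sub>R y))\<^sup>2 = S\<^sup>2 + 2 * S * q * x + q\<^sup>2 * (y \<bullet> y)"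
    unfolding power2_norm_eq_inner
    by (simp add: inner_add_left inner_add_right inner_commute[of y u] uu x_def power2_eq_square
        algebra_simps)
  also have "\<dots> = (R + x)\<^sup>2"
    using q yy by algebra
  finally have "norm (S *\<^sub>R u + q *\<^sub>R y) = R + x"
    using pos by (metis norm_ge_zero power2_eq_iff_nonneg)
  then show ?thesis
    by (simp add: q_def x_def)
qed

text \<open>The left side is the support function of the ellipsoid in direction \<open>u\<close>;
  the square root is \<open>|A u|\<close>. It suffices to exhibit a point of the ellipsoid where
  this value is attained.\<close>

lemma ellipsoid_support:
  fixes u y :: "real ^ 'n"
  assumes orth: "\<And>i j. i \<in> {1..CARD('n)} \<Longrightarrow> j \<in> {1..CARD('n)} \<Longrightarrow>
      v i \<bullet> v j = (if i = j then 1 else 0)"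
    and k: "k \<le> CARD('n)"
    and \<alpha>: "\<And>j. j \<in> {1..k} \<Longrightarrow> 0 < \<alpha> j"
    and sub: "\<And>x. x \<in> ellipsoid k y v \<alpha> \<Longrightarrow> x \<bullet> u \<le> b"
  shows "y \<bullet> u + sqrt (\<Sum>j=1..k. (\<alpha> j * (u \<bullet> v j))\<^sup>2) \<le> b"
proof -
  define h where "h = sqrt (\<Sum>j=1..k. (\<alpha> j * (u \<bullet> v j))\<^sup>2)"
  have h2: "h\<^sup>2 = (\<Sum>j=1..k. (\<alpha> j * (u \<bullet> v j))\<^sup>2)"
    unfolding h_def by (simp add: sum_nonneg)
  show ?thesis
  proof (cases "h = 0")
    case True
    have "y \<in> ellipsoid k y v \<alpha>"
      by (simp add: ellipsoid_def)
    then have "y \<bullet> u \<le> b"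
      by (rule sub)
    with True show ?thesis
      by (simp add: h_def)
  next
    case False
    \<comment> \<open>This is \<open>A^2 u / |A u|\<close>, the equality case of Cauchy-Schwarz. It
      needs \<open>h\<close> nonzero; for \<open>h = 0\<close> the centre does the job.\<close>
    define z where "z = (\<Sum>j=1..k. ((\<alpha> j)\<^sup>2 * (u \<bullet> v j) / h) *\<^sub>R v j)"
    have zv: "z \<bullet> v l = (if l \<in> {1..k} then (\<alpha> l)\<^sup>2 * (u \<bullet> v l) / h else 0)"
      if l: "l \<in> {1..CARD('n)}" for l
    proof -
      have "z \<bullet> v l = (\<Sum>j=1..k. if j = l then (\<alpha> j)\<^sup>2 * (u \<bullet> v j) / h else 0)"
        unfolding z_def inner_sum_left inner_scaleR_left
        using k l by (intro sum.cong refl) (auto simp: orth)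
      then show ?thesis
        by simp
    qed
    have "(\<Sum>j=1..k. (z \<bullet> v j)\<^sup>2 / (\<alpha> j)\<^sup>2) = (\<Sum>j=1..k. (\<alpha> j * (u \<bullet> v j))\<^sup>2 / h\<^sup>2)"
    proof (rule sum.cong)
      fix j assume j: "j \<in> {1..k}"
      then have "z \<bullet> v j = (\<alpha> j)\<^sup>2 * (u \<bullet> v j) / h"
        using zv[of j] k by auto
      moreover have "\<alpha> j \<noteq> 0"
        using \<alpha>[OF j] by simp
      ultimately show "(z \<bullet> v j)\<^sup>2 / (\<alpha> j)\<^sup>2 = (\<alpha> j * (u \<bullet> v j))\<^sup>2 / h\<^sup>2"
        by (simp add: power2_eq_square)
    qed simp
    also have "\<dots> = h\<^sup>2 / h\<^sup>2"
      unfolding h2 sum_divide_distrib ..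
    also have "\<dots> = 1"
      using False by simp
    finally have "y + z \<in> ellipsoid k y v \<alpha>"
      using zv by (auto simp: ellipsoid_def)
    then have "y \<bullet> u + z \<bullet> u \<le> b"
      using sub inner_add_left by metis
    moreover have "z \<bullet> u = h\<^sup>2 / h"
      unfolding h2 z_def inner_sum_left sum_divide_distrib
      by (intro sum.cong refl) (simp add: power2_eq_square inner_commute[of u])
    ultimately show ?thesis
      unfolding h_def[symmetric] using False by (simp add: power2_eq_square)
  qed
qed

text \<open>Take the trace of the decomposition of the identity: each \<open>u i\<close> contributes
  trace 1.\<close>

lemma sum_weights_eq_DIM:
  fixes u :: "'b \<Rightarrow> 'a::euclidean_space"
  assumes frame: "\<And>a b. (\<Sum>i\<in>I. c i * ((u i \<bullet> a) * (u i \<bullet> b))) = a \<bullet> b"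
    and u: "\<And>i. i \<in> I \<Longrightarrow> norm (u i) = 1"
  shows "(\<Sum>i\<in>I. c i) = real DIM('a)"
proof -
  have "(\<Sum>i\<in>I. c i) = (\<Sum>i\<in>I. c i * (u i \<bullet> u i))"
    using u by (intro sum.cong refl) (simp add: norm_eq_1)
  also have "\<dots> = (\<Sum>i\<in>I. \<Sum>b\<in>Basis. c i * ((u i \<bullet> b) * (u i \<bullet> b)))"
    by (simp add: euclidean_inner[of "u _" "u _"] sum_distrib_left)
  also have "\<dots> = (\<Sum>b\<in>Basis. \<Sum>i\<in>I. c i * ((u i \<bullet> b) * (u i \<bullet> b)))"
    by (rule sum.swap)
  also have "\<dots> = (\<Sum>b\<in>(Basis :: 'a set). 1)"
    unfolding frame by (intro sum.cong refl) simp
  finally show ?thesis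
    by simp
qed

lemma sum_semiaxes_bound:
  fixes u :: "'b \<Rightarrow> 'a::euclidean_space" and v :: "'j \<Rightarrow> 'a" and y :: 'a
  assumes frame: "\<And>a b. (\<Sum>i\<in>I. c i * ((u i \<bullet> a) * (u i \<bullet> b))) = a \<bullet> b"
    and centred: "\<And>a. (\<Sum>i\<in>I. c i * (u i \<bullet> a)) = 0"
    and u: "\<And>i. i \<in> I \<Longrightarrow> norm (u i) = 1"
    and c: "\<And>i. i \<in> I \<Longrightarrow> 0 < c i"
    and J: "finite J" "J \<noteq> {}"
    and orth: "\<And>i j. i \<in> J \<Longrightarrow> j \<in> J \<Longrightarrow> v i \<bullet> v j = (if i = j then 1 else 0)"
    and \<alpha>: "\<And>j. j \<in> J \<Longrightarrow> 0 < \<alpha> j"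
    and support: "\<And>i. i \<in> I \<Longrightarrow> sqrt (\<Sum>j\<in>J. (\<alpha> j * (u i \<bullet> v j))\<^sup>2) \<le> 1 - u i \<bullet> y"
  shows "(real (card J) + 1) * (\<Sum>j\<in>J. \<alpha> j)\<^sup>2 \<le>
    real (card J) * (real DIM('a) * (real DIM('a) + 1))"
proof -
  define n where "n = real DIM('a)"
  define S where "S = (\<Sum>j\<in>J. \<alpha> j)"
  define A where "A = (\<lambda>x. \<Sum>j\<in>J. (\<alpha> j * (x \<bullet> v j)) *\<^sub>R v j)"
  define R where "R = sqrt (S\<^sup>2 + (norm y)\<^sup>2)"
  define w where "w = (\<lambda>x. S *\<^sub>R x + (1 + (x \<bullet> y) / (R + S)) *\<^sub>R y)"
  have S: "S > 0"
    unfolding S_def using J \<alpha> by (simp add: sum_pos)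
  have R2: "R\<^sup>2 = S\<^sup>2 + (norm y)\<^sup>2"
    unfolding R_def by simp
  have R: "R > 0"
    unfolding R_def using S by (simp add: add_pos_nonneg)
  have sum_c: "(\<Sum>i\<in>I. c i) = n"
    unfolding n_def by (rule sum_weights_eq_DIM[OF frame u])
  have frame2: "(\<Sum>i\<in>I. c i * (u i \<bullet> a)\<^sup>2) = (norm a)\<^sup>2" for a
    using frame[of a a] by (simp add: power2_eq_square dot_square_norm)
  have nv: "norm (v j) = 1" if "j \<in> J" for j
    using orth[OF that that] by (simp add: norm_eq_1)
  have Av: "A x \<bullet> z = (\<Sum>j\<in>J. \<alpha> j * ((x \<bullet> v j) * (z \<bullet> v j)))" for x z
    unfolding A_def inner_sum_left
    by (intro sum.cong refl) (simp add: inner_commute[of z])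
  have Avj: "A x \<bullet> v l = \<alpha> l * (x \<bullet> v l)" if "l \<in> J" for x l
  proof -
    have "A x \<bullet> v l = (\<Sum>j\<in>J. if j = l then \<alpha> j * (x \<bullet> v j) else 0)"
      unfolding A_def inner_sum_left
      using that by (intro sum.cong refl) (auto simp: orth)
    then show ?thesis
      using that J by simp
  qed
  have normA: "(norm (A x))\<^sup>2 = (\<Sum>j\<in>J. (\<alpha> j * (x \<bullet> v j))\<^sup>2)" for x
    unfolding power2_norm_eq_inner Av[of x "A x"]
    by (intro sum.cong refl) (simp only: Avj power2_eq_square mult_ac)
  have supp: "norm (A (u i)) \<le> 1 - u i \<bullet> y" if "i \<in> I" for i
    using support[OF that] normA[of "u i"] by (metis norm_ge_zero real_sqrt_unique)

  \<comment> \<open>After exchanging the sums, the frame identity at the unit vector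
    \<open>v j\<close> makes each inner sum 1.\<close>
  have "(\<Sum>i\<in>I. c i * (norm (A (u i)))\<^sup>2) =
      (\<Sum>j\<in>J. (\<alpha> j)\<^sup>2 * (\<Sum>i\<in>I. c i * (u i \<bullet> v j)\<^sup>2))"
    unfolding normA sum_distrib_left
    by (subst sum.swap, intro sum.cong refl) (simp add: power_mult_distrib)
  also have "\<dots> = (\<Sum>j\<in>J. (\<alpha> j)\<^sup>2)"
    unfolding frame2 by (intro sum.cong refl) (simp add: nv)
  finally have "(\<Sum>j\<in>J. (\<alpha> j)\<^sup>2) = (\<Sum>i\<in>I. c i * (norm (A (u i)))\<^sup>2)"
    by simp
  also have "\<dots> \<le> (\<Sum>i\<in>I. c i * (1 - u i \<bullet> y)\<^sup>2)"
    using c supp by (intro sum_mono mult_left_mono power_mono) (auto intro: less_imp_le)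
  also have "\<dots> = (\<Sum>i\<in>I. c i - 2 * (c i * (u i \<bullet> y)) + c i * (u i \<bullet> y)\<^sup>2)"
    by (intro sum.cong refl) (simp add: power2_eq_square algebra_simps)
  also have "\<dots> = n + (norm y)\<^sup>2"
    by (simp add: sum.distrib sum_subtractf sum_distrib_left[symmetric] sum_c centred frame2)
  finally have squares: "(\<Sum>j\<in>J. (\<alpha> j)\<^sup>2) \<le> n + (norm y)\<^sup>2" .

  define D where "D = (\<lambda>x. \<Sum>j\<in>J. \<alpha> j * (x \<bullet> v j)\<^sup>2)"
  have boost: "w (u i) \<bullet> A (u i) \<le> (R + u i \<bullet> y) * (1 - u i \<bullet> y)" if i: "i \<in> I" for i
  proof -
    have nw: "norm (w (u i)) = R + u i \<bullet> y"
      unfolding w_def by (rule norm_lorentz_boost[OF u[OF i] S R_def])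
    have "w (u i) \<bullet> A (u i) \<le> norm (w (u i)) * norm (A (u i))"
      by (rule norm_cauchy_schwarz)
    also have "\<dots> \<le> norm (w (u i)) * (1 - u i \<bullet> y)"
      using supp[OF i] by (intro mult_left_mono) auto
    finally show ?thesis
      unfolding nw .
  qed
  \<comment> \<open>Self-adjointness of \<open>A\<close> moves it onto \<open>y\<close>, so that the
    weighted sum of each term can be evaluated by \<open>frame\<close>, \<open>centred\<close> or
    \<open>diag\<close>.\<close>
  have pair: "w x \<bullet> A x =
      S * D x + x \<bullet> A y + (x \<bullet> y) * (x \<bullet> A y) / (R + S)" for x
  proof -
    have "y \<bullet> A x = x \<bullet> A y"
      unfolding inner_commute[of _ "A _"] Av by (simp add: mult.commute)
    moreover have "x \<bullet> A x = D x"
      unfolding inner_commute[of _ "A _"] Av D_def by (simp add: power2_eq_square)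
    ultimately show ?thesis
      unfolding w_def by (simp add: inner_add_left algebra_simps)
  qed
  \<comment> \<open>\<open>D x\<close> is the quadratic form of \<open>A\<close>, so its weighted
    sum over the frame is the trace of \<open>A\<close>.\<close>
  have diag: "(\<Sum>i\<in>I. c i * D (u i)) = S"
  proof -
    have "(\<Sum>i\<in>I. c i * D (u i)) =
        (\<Sum>j\<in>J. \<alpha> j * (\<Sum>i\<in>I. c i * (u i \<bullet> v j)\<^sup>2))"
      unfolding D_def sum_distrib_left by (subst sum.swap, intro sum.cong refl) simp
    also have "\<dots> = S"
      unfolding frame2 S_def by (intro sum.cong refl) (simp add: nv)
    finally show ?thesis .
  qed
  \<comment> \<open>\<open>A\<close> is positive semidefinite. The weighted sum of
    \<open>w (u i) \<bullet> A (u i)\<close> is exactly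
    \<open>S * S + (y \<bullet> A y) / (R + S)\<close>, hence at least \<open>S * S\<close>.\<close>
  have "y \<bullet> A y = (\<Sum>j\<in>J. \<alpha> j * (y \<bullet> v j)\<^sup>2)"
    unfolding inner_commute[of _ "A _"] Av by (simp add: power2_eq_square)
  also have "\<dots> \<ge> 0"
    using \<alpha> by (intro sum_nonneg) (simp add: less_imp_le)
  finally have "S * S \<le> S * S + (y \<bullet> A y) / (R + S)"
    using R S by simp
  also have "\<dots> = S * (\<Sum>i\<in>I. c i * D (u i))
      + (\<Sum>i\<in>I. c i * (u i \<bullet> A y))
      + (\<Sum>i\<in>I. c i * ((u i \<bullet> y) * (u i \<bullet> A y))) / (R + S)"
    unfolding diag frame centred by simp
  also have "\<dots> = (\<Sum>i\<in>I. c i * (w (u i) \<bullet> A (u i)))"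
    unfolding pair sum_distrib_left[of S] sum_divide_distrib sum.distrib[symmetric]
    by (intro sum.cong refl) (simp add: algebra_simps)
  also have "\<dots> \<le> (\<Sum>i\<in>I. c i * ((R + u i \<bullet> y) * (1 - u i \<bullet> y)))"
    using c boost by (intro sum_mono mult_left_mono) (auto intro: less_imp_le)
  also have "\<dots> = (\<Sum>i\<in>I. R * c i + (1 - R) * (c i * (u i \<bullet> y)) - c i * (u i \<bullet> y)\<^sup>2)"
    by (intro sum.cong refl) (simp add: power2_eq_square algebra_simps)
  also have "\<dots> = R * n - (norm y)\<^sup>2"
    by (simp add: sum.distrib sum_subtractf sum_distrib_left[symmetric] sum_c centred frame2)
  finally have "R * R \<le> R * n"
    using R2 by (simp add: power2_eq_square)
  then have "R \<le> n"
    using R by simp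
  then have "R\<^sup>2 \<le> n\<^sup>2"
    using R by (intro power_mono) auto
  then have Sy: "S\<^sup>2 + (norm y)\<^sup>2 \<le> n\<^sup>2"
    unfolding R2 .
  have "S\<^sup>2 \<le> (\<Sum>j\<in>J. (\<alpha> j)\<^sup>2) * real (card J)"
    unfolding S_def by (rule sum_squared_le_sum_of_squares)
  also have "\<dots> \<le> (n + (norm y)\<^sup>2) * real (card J)"
    using squares by (intro mult_right_mono) auto
  \<comment> \<open>Now \<open>S\<close> occurs on both sides with opposite signs; collecting the
    terms produces the factor \<open>card J + 1\<close>.\<close>
  also have "\<dots> \<le> (n + (n\<^sup>2 - S\<^sup>2)) * real (card J)"
    using Sy by (intro mult_right_mono) auto
  finally show ?thesis
    unfolding n_def[symmetric] S_def[symmetric] by (simp add: power2_eq_square algebra_simps)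
qed

lemma prod_le_mean_power:
  fixes x :: "'a \<Rightarrow> real"
  assumes "finite J" "J \<noteq> {}" and x: "\<And>j. j \<in> J \<Longrightarrow> 0 < x j"
  shows "(\<Prod>j\<in>J. x j) \<le> ((\<Sum>j\<in>J. x j) / card J) ^ card J"
proof -
  define P where "P = (\<Prod>j\<in>J. x j)"
  have P: "P > 0"
    unfolding P_def using x by (simp add: prod_pos)
  have J: "card J > 0"
    using assms by (simp add: card_gt_0_iff)
  have "P powr (1 / card J) \<le> (\<Sum>j\<in>J. x j / card J)"
    unfolding P_def by (rule arith_geom_mean) (use assms in \<open>auto intro: less_imp_le\<close>)
  also have "\<dots> = (\<Sum>j\<in>J. x j) / card J"
    by (simp add: sum_divide_distrib)
  finally have "(P powr (1 / card J)) ^ card J \<le> ((\<Sum>j\<in>J. x j) / card J) ^ card J"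
    by (intro power_mono) auto
  moreover have "(P powr (1 / card J)) ^ card J = P"
    using P J by (simp add: powr_realpow[symmetric] powr_powr)
  ultimately show ?thesis
    by (simp add: P_def)
qed

theorem proposition4:
  fixes u :: "nat \<Rightarrow> real ^ 'n" and c :: "nat \<Rightarrow> real" and m k :: nat
    and K :: "(real ^ 'n) set"
    and y :: "real ^ 'n" and v :: "nat \<Rightarrow> real ^ 'n" and \<alpha> :: "nat \<Rightarrow> real"
  assumes "1 \<le> m"
    and "\<And>i. i \<in> {1..m} \<Longrightarrow> norm (u i) = 1"
    and "\<And>i. i \<in> {1..m} \<Longrightarrow> 0 < c i"
    and "(\<Sum>i=1..m. c i *\<^sub>R u i) = 0"
    and "(\<lambda>x. \<Sum>i=1..m. c i *\<^sub>R tensor_square (u i) x) = id"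
    and "K = {x. \<forall>i\<in>{1..m}. x \<bullet> u i \<le> 1}"
    and "1 \<le> k" and "k \<le> CARD('n)"
    and "orthonormal_basis v"
    and "\<And>j. j \<in> {1..k} \<Longrightarrow> 0 < \<alpha> j"
    and "ellipsoid k y v \<alpha> \<subseteq> K"
  shows "ellipsoid_volume k \<alpha> \<le>
    ball_volume k (sqrt (real (CARD('n) * (CARD('n) + 1)) / real (k * (k + 1))))"
proof -
  define S where "S = (\<Sum>j=1..k. \<alpha> j)"
  define n where "n = real CARD('n)"
  have orth: "v i \<bullet> v j = (if i = j then 1 else 0)"
    if "i \<in> {1..CARD('n)}" "j \<in> {1..CARD('n)}" for i j
    using assms(9) that by (simp add: orthonormal_basis_def)
  have frame: "(\<Sum>i=1..m. c i * ((u i \<bullet> a) * (u i \<bullet> b))) = a \<bullet> b" for a b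
  proof -
    have "a \<bullet> b = (\<Sum>i=1..m. c i *\<^sub>R tensor_square (u i) a) \<bullet> b"
      using fun_cong[OF assms(5), of a] by simp
    then show ?thesis
      by (simp add: inner_sum_left tensor_square_def mult.assoc)
  qed
  have centred: "(\<Sum>i=1..m. c i * (u i \<bullet> a)) = 0" for a
    using arg_cong[OF assms(4), of "\<lambda>z. z \<bullet> a"] by (simp add: inner_sum_left)
  have support: "sqrt (\<Sum>j=1..k. (\<alpha> j * (u i \<bullet> v j))\<^sup>2) \<le> 1 - u i \<bullet> y"
    if i: "i \<in> {1..m}" for i
  proof -
    have in_K: "x \<bullet> u i \<le> 1" if "x \<in> ellipsoid k y v \<alpha>" for x
      using that assms(6,11) i by blast
    have "y \<bullet> u i + sqrt (\<Sum>j=1..k. (\<alpha> j * (u i \<bullet> v j))\<^sup>2) \<le> 1"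
      by (rule ellipsoid_support[where v = v and \<alpha> = \<alpha>, OF orth assms(8,10) in_K])
    then show ?thesis
      by (simp add: inner_commute[of y])
  qed
  have "(real k + 1) * S\<^sup>2 \<le> real k * (n * (n + 1))"
    using sum_semiaxes_bound[where v = v and \<alpha> = \<alpha> and J = "{1..k}",
        OF frame centred assms(2,3) _ _ _ assms(10) support]
      assms(7,8) by (simp add: orth S_def n_def)
  \<comment> \<open>The divisor is chosen to leave the square of the mean semi-axis
    \<open>S / k\<close> on the left and the squared radius of the ball on the right.\<close>
  then have "(real k + 1) * S\<^sup>2 / ((real k)\<^sup>2 * (real k + 1)) \<le>
      real k * (n * (n + 1)) / ((real k)\<^sup>2 * (real k + 1))"
    by (rule divide_right_mono) simp
  then have "(S / k)\<^sup>2 \<le> (n * (n + 1)) / (real k * (real k + 1))"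
    using assms(7) by (simp add: power2_eq_square add.commute)
  then have mean: "S / k \<le> sqrt ((n * (n + 1)) / (real k * (real k + 1)))"
    by (rule real_le_rsqrt)
  have S: "S \<ge> 0"
    unfolding S_def using assms(10) by (intro sum_nonneg) (simp add: less_imp_le)
  have "(\<Prod>j=1..k. \<alpha> j) \<le> (S / k) ^ k"
    using prod_le_mean_power[of "{1..k}" \<alpha>] assms(7,10) by (simp add: S_def)
  also have "\<dots> \<le> sqrt ((n * (n + 1)) / (real k * (real k + 1))) ^ k"
    using mean S by (intro power_mono) auto
  also have "(n * (n + 1)) / (real k * (real k + 1)) =
      real (CARD('n) * (CARD('n) + 1)) / real (k * (k + 1))"
    by (simp only: n_def of_nat_mult of_nat_add of_nat_1)
  finally show ?thesis
    unfolding ellipsoid_volume_def ball_volume_def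
    by (intro mult_right_mono) simp_all
qed

end
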